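(* The following assertions are equivalent: (1) $\mathfrak d\le\mathfrak r$. (2) There are bi-$\mathfrak d$-unbounded sets in $[\mathbb N]^\infty$. (3) There are bi-$\operatorname{cf}(\mathfrak d)$-unbounded sets in $[\mathbb N]^\infty$.
   Context: $[\mathbb N]^{\infty}$ is the family of infinite subsets of $\mathbb N$. Each $a\in[\mathbb N]^\infty$ is identified with its increasing enumeration: $a(n)$ is the $n$-th element of $a$. For $a,b\in[\mathbb N]^\infty$: $a\le b$ means $a(n)\le b(n)$ for all $n$; $a\le^* b$ means $a(n)\le b(n)$ for all but finitely many $n$. A set $A\subseteq[\mathbb N]^\infty$ is $\le$-bounded if there is $b\in[\mathbb N]^\infty$ with $a\le b$ for all $a\in A$. A set $D\subseteq[\mathbb N]^\infty$ is dominating if for each $a\in[\mathbb N]^\infty$ there is $d\in D$ with $a\le^* d$; $\mathfrak d$ is the minimal cardinality of a dominating set, and $\operatorname{cf}(\mathfrak d)$ is its cofinality. A set $r\in[\mathbb N]^\infty$ reaps a family $A\subseteq[\mathbb N]^\infty$ if for each $a\in A$ both $a\cap r$ and $a\setminus r$ are infinite; $\mathfrak r$ is the minimal cardinality of a family $A\subseteq[\mathbb N]^\infty$ that no set $r$ reaps. For an infinite cardinal $\kappa$, a set $A\subseteq[\mathbb N]^\infty$ with $|A|\ge\kappa$ is $\kappa$-unbounded if every $\le$-bounded subset of $A$ has cardinality smaller than $\kappa$. For $a\subseteq\mathbb N$ let $a^{c}=\mathbb N\setminus a$, and let $[\mathbb N]^{\infty,\infty}$ be the family of infinite sets $a\subseteq\mathbb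 N$ with $a^c$ infinite. A set $X\subseteq[\mathbb N]^{\infty,\infty}$ is bi-$\kappa$-unbounded if the sets $X$ and $\{x^c: x\in X\}$ are both $\kappa$-unbounded. *)

theory Defs
  imports Main "HOL-Library.Infinite_Set"
begin

unbundle cardinal_syntax

text \<open>
  Cardinals are the cardinal orders of the HOL library, compared by \<open>\<le>o\<close>, \<open><o\<close> and \<open>=o\<close>. The least
  cardinality of a set satisfying \<open>P\<close> is the canonical cardinal \<open>|A|\<close> of a chosen witness \<open>A\<close> of least
  cardinality, so it is determined up to \<open>=o\<close>; it is meaningful only if some set satisfies \<open>P\<close>.
\<close>

definition least_card :: "('a set \<Rightarrow> bool) \<Rightarrow> 'a rel" where
  "least_card P = |(SOME A. P A \<and> (\<forall>B. P B \<longrightarrow> |A| \<le>o |B| ))|"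

lemma least_card_witness:
  assumes "P A"
  shows "\<exists>A. P A \<and> (\<forall>B. P B \<longrightarrow> |A| \<le>o |B| ) \<and> least_card P = |A|"
proof -
  have "\<exists>r \<in> card_of ` Collect P. \<forall>r' \<in> card_of ` Collect P. r \<le>o r'"
    using assms by (intro exists_minim_Well_order) (auto simp: card_of_Well_order)
  then have "\<exists>A. P A \<and> (\<forall>B. P B \<longrightarrow> |A| \<le>o |B| )"
    by auto
  from someI_ex[OF this] show ?thesis
    unfolding least_card_def by blast
qed

text \<open>
  The library predicate \<^const>\<open>cofinal\<close> asks for strictly larger elements; for infinite cardinals this
  is the same as being unbounded.
\<close>

definition cofinality :: "'a rel \<Rightarrow> 'a rel" where
  "cofinality r = least_card (\<lambda>K. K \<subseteq> Field r \<and> cofinal K r)"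

definition inf_sets :: "nat set set" where
  "inf_sets = {a. infinite a}"

definition inf_coinf_sets :: "nat set set" where
  "inf_coinf_sets = {a. infinite a \<and> infinite (- a)}"

text \<open>The increasing enumeration of \<open>a\<close> is \<^term>\<open>enumerate a\<close>, indexed from \<open>0\<close>.\<close>

definition enum_le :: "nat set \<Rightarrow> nat set \<Rightarrow> bool" where
  "enum_le a b \<longleftrightarrow> (\<forall>n. enumerate a n \<le> enumerate b n)"

definition enum_le_star :: "nat set \<Rightarrow> nat set \<Rightarrow> bool" where
  "enum_le_star a b \<longleftrightarrow> (\<forall>\<^sub>\<infinity>n. enumerate a n \<le> enumerate b n)"

definition le_bounded :: "nat set set \<Rightarrow> bool" where
  "le_bounded A \<longleftrightarrow> (\<exists>b \<in> inf_sets. \<forall>a \<in> A. enum_le a b)"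

definition dominating :: "nat set set \<Rightarrow> bool" where
  "dominating D \<longleftrightarrow> D \<subseteq> inf_sets \<and> (\<forall>a \<in> inf_sets. \<exists>d \<in> D. enum_le_star a d)"

definition frak_d :: "nat set rel" where
  "frak_d = least_card dominating"

lemma dominating_inf_sets: "dominating inf_sets"
  unfolding dominating_def enum_le_star_def by (auto intro!: MOST_I bexI)

definition reaps :: "nat set \<Rightarrow> nat set set \<Rightarrow> bool" where
  "reaps r A \<longleftrightarrow> (\<forall>a \<in> A. infinite (a \<inter> r) \<and> infinite (a - r))"

definition unreaped :: "nat set set \<Rightarrow> bool" where
  "unreaped A \<longleftrightarrow> A \<subseteq> inf_sets \<and> \<not> (\<exists>r \<in> inf_sets. reaps r A)"

definition frak_r :: "nat set rel" where
  "frak_r = least_card unreaped"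

lemma unreaped_inf_sets: "unreaped inf_sets"
  unfolding unreaped_def reaps_def by (metis Diff_cancel finite.emptyI subset_refl)

text \<open>The parameter \<open>\<kappa>\<close> is meant to be an infinite cardinal.\<close>

definition unbounded_card :: "'k rel \<Rightarrow> nat set set \<Rightarrow> bool" where
  "unbounded_card \<kappa> A \<longleftrightarrow>
     A \<subseteq> inf_sets \<and> \<kappa> \<le>o |A| \<and> (\<forall>B. B \<subseteq> A \<and> le_bounded B \<longrightarrow> |B| <o \<kappa>)"

definition bi_unbounded_card :: "'k rel \<Rightarrow> nat set set \<Rightarrow> bool" where
  "bi_unbounded_card \<kappa> X \<longleftrightarrow>
     X \<subseteq> inf_coinf_sets \<and> unbounded_card \<kappa> X \<and> unbounded_card \<kappa> {- x | x. x \<in> X}"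

end

theory Submission
  imports Defs
begin

text \<open>
  If \<open>\<dd> \<le> \<rr>\<close>, a bi-unbounded set is built by transfinite recursion. Given fewer than \<open>\<dd>\<close> functions \<open>f\<close>,
  there is \<open>h\<close> such that \<open>f (h n) < h (n + 1)\<close> for infinitely many \<open>n\<close>, for each \<open>f\<close>; a set \<open>r\<close> that
  reaps these sets of indices yields \<open>x = (\<Union>n\<in>r. {h n..<h (n + 1)})\<close>, and neither \<open>x\<close> nor its
  complement is dominated by any \<open>f\<close>.

  If \<open>\<rr> < \<dd>\<close>, then \<open>\<dd>\<close> is regular. For fewer than \<open>\<dd>\<close> functions \<open>f\<close> there is \<open>h\<close> that exceeds each
  \<open>f\<close> infinitely often on each member of a fixed unreaped family of size \<open>\<rr>\<close>. Were a dominating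
  set the union of fewer than \<open>\<dd>\<close> pieces, each of size less than \<open>\<dd>\<close>, take such an \<open>h\<^sub>c\<close> for every
  piece and then such an \<open>h\<close> for the functions \<open>h\<^sub>c\<close>; if \<open>h\<close> is dominated by \<open>f\<close> in the piece \<open>c\<close>,
  then \<open>{m. h\<^sub>c m \<le> f m}\<close> and \<open>{m. h m \<le> h\<^sub>c m}\<close> cover almost all numbers, so the first one
  would reap the family. On the other hand, every \<open>x\<close> or its complement almost contains a member of the unreaped family,
  so any \<open>X\<close> is a union of fewer than \<open>\<dd>\<close> pieces that are bounded or have bounded sets of complements.
  By regularity, \<open>X\<close> is not bi-unbounded for \<open>\<dd>\<close>, which equals its cofinality.
\<close>

declare Field_card_of [simp]

lemma card_of_image_ordLess: "|A| <o r \<Longrightarrow> |f ` A| <o r"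
  using ordLeq_ordLess_trans[OF card_of_image] .

section \<open>Enumerations\<close>

lemma enumerate_range_strict_mono:
  fixes g :: "nat \<Rightarrow> nat"
  assumes "strict_mono g"
  shows "enumerate (range g) = g"
proof -
  have inf: "infinite (range g)"
    using assms by (simp add: range_inj_infinite strict_mono_imp_inj_on)
  have "enumerate (range g) n = g n" for n
  proof (induction n)
    case 0
    show ?case
      unfolding enumerate_0
      by (rule Least_equality) (auto simp: strict_mono_less_eq[OF assms])
  next
    case (Suc n)
    show ?case
      unfolding enumerate_Suc''[OF inf] Suc
      by (rule Least_equality)
        (auto simp: strict_mono_less_eq[OF assms] strict_mono_less[OF assms] Suc_le_eq)
  qed
  then show ?thesis by blast
qed

lemma range_strict_mono_inf_sets: "strict_mono g \<Longrightarrow> range g \<in> inf_sets" for g :: "nat \<Rightarrow> nat"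
  by (simp add: inf_sets_def range_inj_infinite strict_mono_imp_inj_on)

lemma inf_sets_strict_mono: "a \<in> inf_sets \<Longrightarrow> strict_mono (enumerate a)"
  by (simp add: inf_sets_def strict_mono_enumerate)

text \<open>Since \<open>enumerate y k\<close> is at least \<open>k\<close> and belongs to
  \<open>y\<close>, a gap of \<open>y\<close> that starts at \<open>k\<close> must be jumped
  over.\<close>

lemma less_enumerate:
  fixes y :: "nat set"
  assumes "infinite y" and "y \<inter> {k..<l} = {}"
  shows "l \<le> enumerate y k"
proof -
  have "k \<le> enumerate y k" using assms(1) by (rule le_enumerate)
  moreover have "enumerate y k \<in> y" using assms(1) by (rule enumerate_in_set)
  ultimately show ?thesis using assms(2) by (auto simp: disjoint_iff not_less)
qed

lemma enumerate_subset_le: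
  fixes a b :: "nat set"
  assumes "infinite a" and "a \<subseteq> b"
  shows "enumerate b n \<le> enumerate a n"
proof (induction n)
  case 0
  show ?case
    unfolding enumerate_0
    using assms by (metis LeastI Least_le infinite_imp_nonempty ex_in_conv subsetD)
next
  case (Suc n)
  have "infinite b" using assms finite_subset by blast
  moreover have "enumerate b n < enumerate a (Suc n)"
    using Suc enumerate_step[OF assms(1), of n] by linarith
  moreover have "enumerate a (Suc n) \<in> b"
    using enumerate_in_set[OF assms(1)] assms(2) by blast
  ultimately show ?case by (simp add: enumerate_Suc'' Least_le)
qed

text \<open>A subset skips elements, so its enumeration is pointwise larger; the common subset
  \<open>a\<close> itself serves as the bound.\<close>

lemma le_bounded_supersets:
  assumes "infinite a" and "\<And>x. x \<in> B \<Longrightarrow> a \<subseteq> x"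
  shows "le_bounded B"
  unfolding le_bounded_def enum_le_def
  using assms enumerate_subset_le by (auto simp: inf_sets_def)

lemma le_bounded_imp_enum_le_star:
  assumes "dominating D" and "le_bounded B"
  shows "\<exists>d\<in>D. \<forall>x\<in>B. enum_le_star x d"
proof -
  obtain b where b: "b \<in> inf_sets" "\<And>x n. x \<in> B \<Longrightarrow> enumerate x n \<le> enumerate b n"
    using assms(2) unfolding le_bounded_def enum_le_def by blast
  then obtain d where d: "d \<in> D" "enum_le_star b d"
    using assms(1) unfolding dominating_def by blast
  have "enum_le_star x d" if "x \<in> B" for x
    using d(2) unfolding enum_le_star_def
    by (rule MOST_mono) (use b(2)[OF that] order_trans in blast)
  with d(1) show ?thesis by blast
qed

section \<open>The dominating number\<close>

lemma frak_d_witness: "\<exists>D. dominating D \<and> frak_d = |D| \<and> (\<forall>B. dominating B \<longrightarrow> |D| \<le>o |B| )"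
  using least_card_witness[of dominating, OF dominating_inf_sets] unfolding frak_d_def by blast

lemma frak_r_witness: "\<exists>A. unreaped A \<and> frak_r = |A| \<and> (\<forall>B. unreaped B \<longrightarrow> |A| \<le>o |B| )"
  using least_card_witness[of unreaped, OF unreaped_inf_sets] unfolding frak_r_def by blast

lemma Card_order_frak_d: "Card_order frak_d"
  using frak_d_witness card_of_Card_order by metis

lemma Card_order_frak_r: "Card_order frak_r"
  using frak_r_witness card_of_Card_order by metis

text \<open>Strictly increasing functions are the enumerations of their ranges, and fewer than
  \<open>frak_d\<close> ranges cannot dominate.\<close>

lemma not_dominated:
  fixes G :: "(nat \<Rightarrow> nat) set"
  assumes "\<And>g. g \<in> G \<Longrightarrow> strict_mono g" and "|G| <o frak_d"
  shows "\<exists>h\<in>inf_sets. \<forall>g\<in>G. \<exists>\<^sub>\<infinity>n. g n < enumerate h n"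
proof -
  have "|range ` G| <o frak_d"
    using assms(2) by (rule card_of_image_ordLess)
  then have "\<not> dominating (range ` G)"
    using frak_d_witness not_ordLess_ordLeq by metis
  moreover have "range ` G \<subseteq> inf_sets"
    using assms(1) range_strict_mono_inf_sets by blast
  ultimately obtain h where h: "h \<in> inf_sets" "\<forall>g\<in>G. \<not> enum_le_star h (range g)"
    unfolding dominating_def by auto
  have "\<exists>\<^sub>\<infinity>n. g n < enumerate h n" if "g \<in> G" for g
    using h(2)[rule_format, OF that]
    unfolding enum_le_star_def enumerate_range_strict_mono[OF assms(1)[OF that]]
    by (simp add: not_le)
  with h(1) show ?thesis by blast
qed

lemma countable_not_dominating:
  fixes d :: "nat \<Rightarrow> nat set"
  shows "\<not> dominating (range d)"
proof
  assume dom: "dominating (range d)"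
  \<comment> \<open>A diagonal function: the inner sum exceeds the first \<open>j + 1\<close>
    enumerations at \<open>j\<close>, and the outer sum of successors makes \<open>h\<close>
    strictly increasing.\<close>
  define h where "h = (\<lambda>m. \<Sum>j\<le>m. Suc (\<Sum>n\<le>j. enumerate (d n) j))"
  have "strict_mono h"
    unfolding h_def by (rule strict_mono_Suc_iff[THEN iffD2]) simp
  then have range_h: "range h \<in> inf_sets" "enumerate (range h) = h"
    using range_strict_mono_inf_sets enumerate_range_strict_mono by blast+
  have less: "enumerate (d n) m < h m" if "n \<le> m" for n m
  proof -
    have "enumerate (d n) m \<le> (\<Sum>n\<le>m. enumerate (d n) m)"
      using that by (intro member_le_sum) auto
    also have "\<dots> < Suc (\<Sum>n\<le>m. enumerate (d n) m)" by simp
    also have "\<dots> \<le> h m"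
      unfolding h_def
      by (rule member_le_sum[where f = "\<lambda>j. Suc (\<Sum>n\<le>j. enumerate (d n) j)"]) auto
    finally show ?thesis .
  qed
  obtain d' where "d' \<in> range d" "enum_le_star (range h) d'"
    using dom range_h(1) unfolding dominating_def by blast
  then obtain n where "\<forall>\<^sub>\<infinity>m. h m \<le> enumerate (d n) m"
    unfolding enum_le_star_def range_h(2) by blast
  then obtain k where "\<forall>m\<ge>k. h m \<le> enumerate (d n) m"
    unfolding MOST_nat_le by blast
  then have "h (max n k) \<le> enumerate (d n) (max n k)" by simp
  with less[of n "max n k"] show False by simp
qed

lemma nat_ordLess_frak_d: "|UNIV :: nat set| <o frak_d"
proof -
  obtain D where D: "dominating D" "frak_d = |D|" using frak_d_witness by blast
  have "D \<noteq> {}" using D(1) unfolding dominating_def inf_sets_def by auto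
  then have "\<not> |D| \<le>o |UNIV :: nat set|"
    using countable_not_dominating D(1) card_of_ordLeq2[of D UNIV] by metis
  then have "|UNIV :: nat set| <o |D|"
    by (rule not_ordLeq_iff_ordLess[THEN iffD1, OF card_of_Well_order card_of_Well_order])
  with D(2) show ?thesis by simp
qed

lemma infinite_Field_frak_d: "infinite (Field frak_d)"
proof -
  obtain D where D: "frak_d = |D|" using frak_d_witness by blast
  with nat_ordLess_frak_d have "infinite D"
    by (metis card_of_ordLeq_infinite infinite_UNIV_nat ordLess_imp_ordLeq)
  then show ?thesis unfolding D by simp
qed

lemma Un_ordLess_frak_d: "|A| <o frak_d \<Longrightarrow> |B| <o frak_d \<Longrightarrow> |A \<union> B| <o frak_d"
  using card_of_Un_ordLess_infinite_Field infinite_Field_frak_d Card_order_frak_d by blast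

lemma finite_ordLess_frak_d: "finite A \<Longrightarrow> |A| <o frak_d"
  using nat_ordLess_frak_d finite_iff_ordLess_natLeq card_of_nat
  by (meson ordIso_symmetric ordLess_ordIso_trans ordLess_transitive)

lemma insert_ordLess_frak_d: "|A| <o frak_d \<Longrightarrow> |insert x A| <o frak_d"
  using Un_ordLess_frak_d[OF finite_ordLess_frak_d[of "{x}"]] by simp

lemma Times_ordLess_frak_d:
  fixes A :: "'a set" and B :: "'b set"
  assumes "|A| <o frak_d" and "|B| <o frak_d"
  shows "|A \<times> B| <o frak_d"
proof -
  \<comment> \<open>The copy of the naturals makes \<open>M\<close> infinite even if
    \<open>A\<close> and \<open>B\<close> are finite, so that \<open>M\<close> absorbs the product
    while staying below \<open>frak_d\<close>.\<close>
  define M where "M = (A <+> B) <+> (UNIV :: nat set)"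
  obtain D where D: "frak_d = |D|" using frak_d_witness by blast
  have "infinite D" using infinite_Field_frak_d unfolding D by simp
  then have "|M| <o |D|"
    unfolding M_def using assms nat_ordLess_frak_d D
    by (intro card_of_Plus_ordLess_infinite) auto
  have "infinite M" unfolding M_def by simp
  then have "infinite (Field |M| )" by simp
  moreover have "|A| \<le>o |M|" "|B| \<le>o |M|"
    unfolding M_def by (meson card_of_Plus1 card_of_Plus2 ordLeq_transitive)+
  ultimately have "|A \<times> B| \<le>o |M|"
    using card_of_Times_ordLeq_infinite_Field card_of_Card_order by blast
  with \<open>|M| <o |D|\<close> D show ?thesis using ordLeq_ordLess_trans by metis
qed

section \<open>Avoiding few functions\<close>

text \<open>If \<open>h (n + 1) \<le> f (h n)\<close> from some \<open>N\<close> on, then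
  \<open>h (N + k)\<close> is at most the \<open>k\<close>-fold iterate of \<open>f\<close> at
  \<open>h N\<close>. The diagonal iterate \<open>g f\<close> eventually dominates all such
  sequences, so any \<open>h\<close> that escapes every \<open>g f\<close> works.\<close>

lemma interval_growth:
  assumes "F \<subseteq> inf_sets" and "|F| <o frak_d"
  shows "\<exists>h\<in>inf_sets. \<forall>f\<in>F. \<exists>\<^sub>\<infinity>n. enumerate f (enumerate h n) < enumerate h (Suc n)"
proof -
  define g where "g = (\<lambda>(f :: nat set) (m :: nat). (enumerate f ^^ m) m)"
  have mono: "strict_mono (enumerate f ^^ m)" if "f \<in> F" for f m
  proof (induction m)
    case (Suc m)
    have "strict_mono (enumerate f)"
      using that assms(1) inf_sets_strict_mono by blast
    then show ?case using Suc by (auto simp: strict_mono_def)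
  qed (simp add: strict_mono_def)
  have "strict_mono (g f)" if "f \<in> F" for f
    unfolding strict_mono_Suc_iff
  proof
    fix m
    have "m < Suc m" by simp
    then have "g f m < (enumerate f ^^ m) (Suc m)"
      unfolding g_def using mono[OF that] by (rule strict_monoD[rotated])
    also have "\<dots> \<le> enumerate f ((enumerate f ^^ m) (Suc m))"
      using that assms(1) by (auto simp: inf_sets_def intro: le_enumerate)
    finally show "g f m < g f (Suc m)" by (simp add: g_def)
  qed
  moreover have "|g ` F| <o frak_d"
    using assms(2) by (rule card_of_image_ordLess)
  ultimately obtain h where h: "h \<in> inf_sets"
    and inf: "\<And>f. f \<in> F \<Longrightarrow> \<exists>\<^sub>\<infinity>n. g f n < enumerate h n"
    using not_dominated[of "g ` F"] by auto
  have "\<exists>\<^sub>\<infinity>n. enumerate f (enumerate h n) < enumerate h (Suc n)" if f: "f \<in> F" for f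
  proof (rule ccontr)
    assume "\<not> ?thesis"
    then obtain N where N: "\<And>n. n \<ge> N \<Longrightarrow> enumerate h (Suc n) \<le> enumerate f (enumerate h n)"
      by (auto simp: MOST_nat_le not_less)
    have sm: "strict_mono (enumerate f)" using f assms(1) inf_sets_strict_mono by blast
    have iter: "enumerate h (N + k) \<le> (enumerate f ^^ k) (enumerate h N)" for k
    proof (induction k)
      case (Suc k)
      have "enumerate h (N + Suc k) \<le> enumerate f (enumerate h (N + k))"
        using N[of "N + k"] by simp
      also have "\<dots> \<le> enumerate f ((enumerate f ^^ k) (enumerate h N))"
        using Suc sm by (simp add: strict_mono_less_eq)
      finally show ?case by simp
    qed simp
    \<comment> \<open>The threshold ensures both \<open>m \<ge> N\<close> and
      \<open>enumerate h N \<le> m\<close>; adding the missing \<open>N\<close> iterations only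
      increases the value and completes the \<open>m\<close>-fold iterate.\<close>
    have "enumerate h m \<le> g f m" if m: "m \<ge> N + enumerate h N" for m
    proof -
      define k where "k = m - N"
      have k: "m = N + k" "enumerate h N \<le> m" using m by (auto simp: k_def)
      have "enumerate h m \<le> (enumerate f ^^ k) (enumerate h N)" using iter k(1) by simp
      also have "\<dots> \<le> (enumerate f ^^ k) m"
        using k(2) mono[OF f] by (simp add: strict_mono_less_eq)
      also have "\<dots> \<le> (enumerate f ^^ k) ((enumerate f ^^ N) m)"
        using mono[OF f] by (simp add: strict_mono_less_eq strict_mono_imp_increasing)
      also have "\<dots> = g f m" by (simp add: g_def k(1) add.commute[of N] funpow_add)
      finally show ?thesis .
    qed
    then have "\<forall>\<^sub>\<infinity>m. \<not> g f m < enumerate h m" by (auto simp: MOST_nat_le not_less)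
    with inf[OF f] show False by (simp add: frequently_def)
  qed
  with h show ?thesis by blast
qed

text \<open>At the index \<open>enumerate h n\<close>, the gap pushes \<open>y\<close> up to at
  least \<open>enumerate h (Suc n)\<close>, which is beyond \<open>f\<close>. These indices are
  unbounded as \<open>n\<close> runs through \<open>N\<close>.\<close>

lemma gap_not_enum_le_star:
  assumes "infinite y" and "infinite N"
    and "\<And>n. n \<in> N \<Longrightarrow> enumerate f (enumerate h n) < enumerate h (Suc n)"
    and "\<And>n. n \<in> N \<Longrightarrow> y \<inter> {enumerate h n..<enumerate h (Suc n)} = {}"
    and "h \<in> inf_sets"
  shows "\<not> enum_le_star y f"
proof
  assume "enum_le_star y f"
  then obtain k where k: "\<And>m. m \<ge> k \<Longrightarrow> enumerate y m \<le> enumerate f m"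
    unfolding enum_le_star_def MOST_nat_le by blast
  obtain n where n: "n \<in> N" "n \<ge> k" using assms(2) unfolding infinite_nat_iff_unbounded_le by blast
  have "n \<le> enumerate h n" using assms(5) by (simp add: inf_sets_def le_enumerate)
  then have "enumerate y (enumerate h n) \<le> enumerate f (enumerate h n)" using k n(2) by simp
  also have "\<dots> < enumerate h (Suc n)" using assms(3) n(1) by blast
  also have "\<dots> \<le> enumerate y (enumerate h n)"
    using less_enumerate[OF assms(1) assms(4)[OF n(1)]] .
  finally show False by simp
qed

lemma avoid_few:
  assumes le: "frak_d \<le>o frak_r" and F0: "F \<subseteq> inf_sets" "|F| <o frak_d"
  shows "\<exists>x\<in>inf_coinf_sets. \<forall>f\<in>F. \<not> enum_le_star x f \<and> \<not> enum_le_star (- x) f"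
proof -
  \<comment> \<open>The additional member \<open>UNIV\<close> guarantees that \<open>r\<close> and
    its complement are infinite even when \<open>F\<close> is empty.\<close>
  define F' where "F' = insert UNIV F"
  have F: "F' \<subseteq> inf_sets" "|F'| <o frak_d"
    using F0 insert_ordLess_frak_d by (auto simp: F'_def inf_sets_def)
  obtain h where h: "h \<in> inf_sets"
    and hF: "\<And>f. f \<in> F' \<Longrightarrow> \<exists>\<^sub>\<infinity>n. enumerate f (enumerate h n) < enumerate h (Suc n)"
    using interval_growth[OF F] by blast
  define N where "N = (\<lambda>f. {n. enumerate f (enumerate h n) < enumerate h (Suc n)})"
  have "|N ` F'| <o frak_d"
    using F(2) by (rule card_of_image_ordLess)
  then have "|N ` F'| <o frak_r" using le ordLess_ordLeq_trans by blast
  then have "\<not> unreaped (N ` F')"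
    using frak_r_witness not_ordLess_ordLeq by metis
  moreover have "N ` F' \<subseteq> inf_sets"
    using hF by (auto simp: N_def inf_sets_def INFM_iff_infinite)
  ultimately obtain r where "reaps r (N ` F')" unfolding unreaped_def by blast
  then have r: "infinite (N f \<inter> r)" "infinite (N f - r)" if "f \<in> F'" for f
    using that unfolding reaps_def by auto
  define I where "I = (\<lambda>n. {enumerate h n..<enumerate h (Suc n)})"
  have I': "I n = {enumerate h n..<enumerate h (Suc n)}" for n by (simp add: I_def)
  have hm: "strict_mono (enumerate h)" using h by (rule inf_sets_strict_mono)
  have disj: "m = n" if "i \<in> I m" "i \<in> I n" for i m n
  proof (rule ccontr)
    assume "m \<noteq> n"
    then consider "Suc m \<le> n" | "Suc n \<le> m" by linarith
    then show False
    proof cases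
      case 1
      then have "enumerate h (Suc m) \<le> enumerate h n" using hm by (simp add: strict_mono_less_eq)
      with that show False by (simp add: I_def)
    next
      case 2
      then have "enumerate h (Suc n) \<le> enumerate h m" using hm by (simp add: strict_mono_less_eq)
      with that show False by (simp add: I_def)
    qed
  qed
  have start: "enumerate h n \<in> I n" for n
    using hm by (simp add: I_def strict_mono_less)
  \<comment> \<open>\<open>x\<close> omits the intervals outside \<open>r\<close>, and
    \<open>- x\<close> those inside. As \<open>r\<close> splits every \<open>N f\<close>, both have
    infinitely many gaps on which \<open>h\<close> outgrows \<open>f\<close>.\<close>
  define x where "x = (\<Union>n\<in>r. I n)"
  \<comment> \<open>The left end points of the intervals carry the infinity of \<open>r\<close> and
    \<open>- r\<close> over to \<open>x\<close> and \<open>- x\<close>.\<close>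
  have in_x: "enumerate h n \<in> x \<longleftrightarrow> n \<in> r" for n
    using disj start unfolding x_def by blast
  have inj: "inj_on (enumerate h) S" for S
    using hm by (rule strict_mono_imp_inj_on)
  have UNIV: "UNIV \<in> F'" by (simp add: F'_def)
  have "infinite r" using r(1)[OF UNIV] by auto
  then have "infinite (enumerate h ` r)" using inj finite_imageD by blast
  then have x: "infinite x" using in_x by (meson finite_subset image_subsetI)
  have "infinite (- r)" using r(2)[OF UNIV] by (auto simp: Diff_eq)
  then have "infinite (enumerate h ` (- r))" using inj finite_imageD by blast
  then have cx: "infinite (- x)" using in_x by (meson ComplD ComplI finite_subset image_subsetI)
  have "\<not> enum_le_star x f" if "f \<in> F" for f
  proof (rule gap_not_enum_le_star[OF x])
    show "infinite (N f - r)" using r that by (simp add: F'_def)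
    show "x \<inter> {enumerate h n..<enumerate h (Suc n)} = {}" if "n \<in> N f - r" for n
      using that disj unfolding x_def by (fold I') blast
  qed (auto simp: N_def h)
  moreover have "\<not> enum_le_star (- x) f" if "f \<in> F" for f
  proof (rule gap_not_enum_le_star[OF cx])
    show "infinite (N f \<inter> r)" using r that by (simp add: F'_def)
    show "- x \<inter> {enumerate h n..<enumerate h (Suc n)} = {}" if "n \<in> N f \<inter> r" for n
      using that unfolding x_def by (fold I') blast
  qed (auto simp: N_def h)
  ultimately show ?thesis using x cx unfolding inf_coinf_sets_def by blast
qed

section \<open>Construction of bi-unbounded sets\<close>

text \<open>A bounded \<open>B\<close> lies almost everywhere below one \<open>d\<close> in
  \<open>D\<close>, and \<open>d\<close> is in some piece \<open>S c'\<close>. From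
  \<open>c'\<close> on, all \<open>x c\<close> avoid \<open>d\<close>, so \<open>B\<close> comes
  from the proper initial segment below \<open>c'\<close>, which has fewer than \<open>|C|\<close>
  elements.\<close>

lemma unbounded_card_image:
  fixes x :: "'c \<Rightarrow> nat set"
  assumes dom: "dominating D" and D: "D \<subseteq> (\<Union>c\<in>C. S c)"
    and x: "inj_on x C" "x ` C \<subseteq> inf_sets"
    and avoid: "\<And>c c' d. c \<in> C \<Longrightarrow> c' \<in> C \<Longrightarrow> (c', c) \<in> |C| \<Longrightarrow> d \<in> S c' \<Longrightarrow> \<not> enum_le_star (x c) d"
  shows "unbounded_card (card_of C) (x ` C)"
  unfolding unbounded_card_def
proof (intro conjI allI impI)
  show "x ` C \<subseteq> inf_sets" by fact
  show "|C| \<le>o |x ` C|"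
    using card_of_ordLeq[of C "x ` C"] x(1) by blast
  fix B assume B: "B \<subseteq> x ` C \<and> le_bounded B"
  then obtain d where d: "d \<in> D" "\<And>y. y \<in> B \<Longrightarrow> enum_le_star y d"
    using le_bounded_imp_enum_le_star[OF dom, of B] by blast
  obtain c' where c': "c' \<in> C" "d \<in> S c'" using D d(1) by blast
  have wo: "wo_rel |C|" using card_of_Well_order by (simp add: wo_rel_def)
  have "B \<subseteq> x ` underS (card_of C) c'"
  proof
    fix y assume "y \<in> B"
    then obtain c where c: "c \<in> C" "y = x c" "enum_le_star (x c) d" using B d(2) by blast
    then have "(c', c) \<notin> |C|" using avoid c' by blast
    then have "c \<in> underS (card_of C) c'"
      using wo_rel.TOTALS[OF wo] wo_rel.REFL[OF wo] c(1) c'(1)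
      unfolding underS_def refl_on_def by auto
    with c(2) show "y \<in> x ` underS (card_of C) c'" by blast
  qed
  then have "|B| \<le>o |underS (card_of C) c'|"
    using ordLeq_transitive[OF card_of_mono1 card_of_image] by blast
  also have "|underS (card_of C) c'| <o |C|"
    using card_of_underS[OF card_of_Card_order] c'(1) by simp
  finally show "|B| <o |C|" .
qed

text \<open>The index set and the pieces are kept general to serve both cardinals: singletons
  indexed by \<open>D\<close> give \<open>frak_d\<close>, and initial segments indexed by a cofinal
  set give its cofinality. Hypothesis \<open>small\<close> leaves fewer than \<open>frak_d\<close>
  sets to avoid at each stage.\<close>

lemma bi_unbounded_exists:
  fixes C :: "'c set"
  assumes le: "frak_d \<le>o frak_r" and dom: "dominating D" and D: "D = (\<Union>c\<in>C. S c)"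
    and C: "|C| \<le>o frak_d"
    and small: "\<And>c. c \<in> C \<Longrightarrow> |\<Union>c'\<in>under (card_of C) c. S c'| <o frak_d"
  shows "\<exists>X. bi_unbounded_card (card_of C) X"
proof -
  define L where "L = ( |C| - Id)"
  have "wf L"
    unfolding L_def using card_of_Well_order[of C] by (auto simp: well_order_on_def)
  \<comment> \<open>Avoiding the earlier values of \<open>f\<close> as well makes the resulting family injective.\<close>
  define P where "P = (\<lambda>(f :: 'c \<Rightarrow> nat set) c x. c \<in> C \<longrightarrow>
    x \<in> inf_coinf_sets \<and>
    (\<forall>d \<in> (\<Union>c'\<in>under (card_of C) c. S c') \<union> f ` underS (card_of C) c.
      \<not> enum_le_star x d \<and> \<not> enum_le_star (- x) d))"
  have sub: "under (card_of C) c \<subseteq> C" "underS (card_of C) c \<subseteq> C" for c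
    using under_Field[of "|C|" c] underS_subset_under[of "|C|" c] by auto
  \<comment> \<open>Well-founded recursion along the strict part of \<open>|C|\<close>. It runs over
    the whole type, and outside \<open>C\<close> the condition \<open>P\<close> is vacuous.\<close>
  have "\<exists>x. \<forall>c. P x c (x c)"
  proof (rule dependent_wf_choice[OF \<open>wf L\<close>])
    fix f g :: "'c \<Rightarrow> nat set" and c x assume "\<And>z. (z, c) \<in> L \<Longrightarrow> f z = g z"
    then have "f ` underS (card_of C) c = g ` underS (card_of C) c"
      by (intro image_cong) (auto simp: underS_def L_def)
    then show "P f c x = P g c x" by (simp add: P_def)
  next
    fix c and f :: "'c \<Rightarrow> nat set" assume IH: "\<And>y. (y, c) \<in> L \<Longrightarrow> P f y (f y)"
    show "\<exists>x. P f c x"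
    proof (cases "c \<in> C")
      case True
      have "f y \<in> inf_sets" if "y \<in> underS (card_of C) c" for y
        using IH[of y] that sub unfolding P_def L_def underS_def inf_sets_def inf_coinf_sets_def
        by blast
      moreover have "S c' \<subseteq> inf_sets" if "c' \<in> under (card_of C) c" for c'
        using that sub dom D unfolding dominating_def by blast
      ultimately have "(\<Union>c'\<in>under (card_of C) c. S c') \<union> f ` underS (card_of C) c \<subseteq> inf_sets" by blast
      moreover have "|f ` underS (card_of C) c| <o frak_d"
      proof (rule card_of_image_ordLess)
        have "|underS (card_of C) c| <o |C|"
          using True by (intro card_of_underS card_of_Card_order) simp
        then show "|underS (card_of C) c| <o frak_d" using C by (rule ordLess_ordLeq_trans)
      qed
      then have "|(\<Union>c'\<in>under (card_of C) c. S c') \<union> f ` underS (card_of C) c| <o frak_d"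
        using Un_ordLess_frak_d small[OF True] by blast
      ultimately obtain x where "x \<in> inf_coinf_sets"
        "\<forall>d \<in> (\<Union>c'\<in>under (card_of C) c. S c') \<union> f ` underS (card_of C) c.
          \<not> enum_le_star x d \<and> \<not> enum_le_star (- x) d"
        using avoid_few[OF le] by meson
      then have "P f c x" unfolding P_def by blast
      then show ?thesis ..
    qed (simp add: P_def)
  qed
  then obtain x where "\<And>c. P x c (x c)" by blast
  then have x: "\<And>c. c \<in> C \<Longrightarrow> x c \<in> inf_coinf_sets"
    and S: "\<And>c c' d. c \<in> C \<Longrightarrow> c' \<in> under (card_of C) c \<Longrightarrow> d \<in> S c' \<Longrightarrow>
      \<not> enum_le_star (x c) d \<and> \<not> enum_le_star (- x c) d"
    and new: "\<And>c c'. c \<in> C \<Longrightarrow> c' \<in> underS (card_of C) c \<Longrightarrow> \<not> enum_le_star (x c) (x c')"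
    unfolding P_def by auto
  have wo: "wo_rel |C|" using card_of_Well_order by (simp add: wo_rel_def)
  have refl: "enum_le_star y y" for y unfolding enum_le_star_def by simp
  have inj: "inj_on x C"
  proof (rule inj_onI, rule ccontr)
    fix c c' assume "c \<in> C" "c' \<in> C" "x c = x c'" "c \<noteq> c'"
    moreover from this have "c \<in> underS (card_of C) c' \<or> c' \<in> underS (card_of C) c"
      using wo_rel.TOTALS[OF wo] unfolding underS_def by auto
    ultimately show False using new refl by metis
  qed
  have "unbounded_card (card_of C) (x ` C)"
    using x S D by (intro unbounded_card_image[OF dom _ inj, of S])
      (auto simp: inf_coinf_sets_def inf_sets_def under_def)
  moreover have "unbounded_card (card_of C) ((\<lambda>c. - x c) ` C)"
  proof (rule unbounded_card_image[OF dom])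
    show "inj_on (\<lambda>c. - x c) C" using inj by (simp add: inj_on_def)
    show "D \<subseteq> (\<Union>c\<in>C. S c)" using D by simp
    show "(\<lambda>c. - x c) ` C \<subseteq> inf_sets"
      using x by (auto simp: inf_coinf_sets_def inf_sets_def)
    show "\<not> enum_le_star (- x c) d" if "c \<in> C" "(c', c) \<in> |C|" "d \<in> S c'" for c c' d
      using S[of c c' d] that by (simp add: under_def)
  qed
  moreover have "(\<lambda>c. - x c) ` C = {- y |y. y \<in> x ` C}" by blast
  moreover have "x ` C \<subseteq> inf_coinf_sets" using x by blast
  ultimately have "bi_unbounded_card (card_of C) (x ` C)"
    unfolding bi_unbounded_card_def by simp
  then show ?thesis ..
qed

section \<open>Cofinality\<close>

lemma Card_order_cofinal_Field:
  assumes "Card_order r" and "infinite (Field r)"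
  shows "cofinal (Field r) r"
  unfolding cofinal_def using infinite_Card_order_limit[OF assms] by blast

lemma cofinality_witness:
  assumes "Card_order r" and "infinite (Field r)"
  shows "\<exists>C\<subseteq>Field r. cofinal C r \<and> cofinality r = |C| \<and>
    (\<forall>K. K \<subseteq> Field r \<and> cofinal K r \<longrightarrow> |C| \<le>o |K| )"
  using least_card_witness[of "\<lambda>K. K \<subseteq> Field r \<and> cofinal K r" "Field r"]
    Card_order_cofinal_Field[OF assms]
  unfolding cofinality_def by blast

text \<open>An infinite cardinal has no last element, so the closed segment at \<open>a\<close> fits
  into the open segment at some larger \<open>b\<close>.\<close>

lemma card_of_under:
  assumes "Card_order r" and "infinite (Field r)" and "a \<in> Field r"
  shows "|under r a| <o r"
proof -
  obtain b where b: "b \<in> Field r" "a \<noteq> b" "(a, b) \<in> r"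
    using infinite_Card_order_limit[OF assms] by blast
  have wo: "wo_rel r" using assms(1) by (simp add: card_order_on_def wo_rel_def)
  have "under r a \<subseteq> underS r b"
    using b wo_rel.TRANS[OF wo] wo_rel.ANTISYM[OF wo]
    unfolding under_def underS_def trans_def antisym_def by blast
  then have "|under r a| \<le>o |underS r b|" by (rule card_of_mono1)
  also have "|underS r b| <o r" using card_of_underS[OF assms(1) b(1)] .
  finally show ?thesis .
qed

lemma cofinal_Union_under:
  assumes "C \<subseteq> Field r" and "cofinal C r"
  shows "(\<Union>c\<in>C. under r c) = Field r"
proof
  show "(\<Union>c\<in>C. under r c) \<subseteq> Field r" using under_Field[of r] by blast
  show "Field r \<subseteq> (\<Union>c\<in>C. under r c)"
    using assms(2) unfolding cofinal_def under_def by blast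
qed

text \<open>A set that is not cofinal has an upper bound \<open>a\<close>, so the whole union lies
  in the single segment \<open>under r a\<close>. This covers singular \<open>r\<close> as
  well.\<close>

lemma small_not_cofinal_Union_under:
  assumes r: "Card_order r" "infinite (Field r)"
    and "B \<subseteq> Field r" and "\<not> cofinal B r"
  shows "|\<Union>c\<in>B. under r c| <o r"
proof -
  obtain a where a: "a \<in> Field r" "\<And>b. b \<in> B \<Longrightarrow> a = b \<or> (a, b) \<notin> r"
    using assms(4) unfolding cofinal_def by blast
  have wo: "wo_rel r" using r(1) by (simp add: card_order_on_def wo_rel_def)
  have "(b, a) \<in> r" if "b \<in> B" for b
    using a that assms(3) wo_rel.TOTALS[OF wo] wo_rel.REFL[OF wo] unfolding refl_on_def by blast
  then have "(\<Union>c\<in>B. under r c) \<subseteq> under r a"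
    using wo_rel.TRANS[OF wo] unfolding under_def trans_def by blast
  then have "|\<Union>c\<in>B. under r c| \<le>o |under r a|" by (rule card_of_mono1)
  also have "|under r a| <o r" using card_of_under[OF r a(1)] .
  finally show ?thesis .
qed

section \<open>Regularity of the dominating number\<close>

text \<open>Apply \<open>not_dominated\<close> to the compositions of \<open>f\<close> with the
  enumeration of \<open>a\<close>. If \<open>h\<close> exceeds such a composition at
  \<open>n\<close>, then it exceeds \<open>f\<close> at the \<open>n\<close>-th element of
  \<open>a\<close>, which is at least \<open>n\<close>.\<close>

lemma exceeds_on:
  assumes A: "A \<subseteq> inf_sets" "|A| <o frak_d" and F: "F \<subseteq> inf_sets" "|F| <o frak_d"
  shows "\<exists>h\<in>inf_sets. \<forall>f\<in>F. \<forall>a\<in>A. infinite {m\<in>a. enumerate f m < enumerate h m}"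
proof -
  define G where "G = (\<lambda>(a, f). enumerate f \<circ> enumerate a) ` (A \<times> F)"
  have "|G| <o frak_d"
    unfolding G_def using Times_ordLess_frak_d[OF A(2) F(2)] by (rule card_of_image_ordLess)
  moreover have "strict_mono g" if "g \<in> G" for g
  proof -
    obtain a f where g: "g = enumerate f \<circ> enumerate a" "a \<in> inf_sets" "f \<in> inf_sets"
      using \<open>g \<in> G\<close> A(1) F(1) unfolding G_def by auto
    show ?thesis
      unfolding g(1)
      using g(2,3)[THEN inf_sets_strict_mono] by (simp add: strict_mono_def)
  qed
  ultimately obtain h where h: "h \<in> inf_sets" "\<And>g. g \<in> G \<Longrightarrow> \<exists>\<^sub>\<infinity>n. g n < enumerate h n"
    using not_dominated[of G] by blast
  have "infinite {m\<in>a. enumerate f m < enumerate h m}" if "f \<in> F" "a \<in> A" for f a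
  proof -
    have a: "infinite a" using that A(1) by (auto simp: inf_sets_def)
    have "enumerate f \<circ> enumerate a \<in> G" using that unfolding G_def by force
    from h(2)[OF this] have "infinite {n. enumerate f (enumerate a n) < enumerate h n}"
      by (simp add: INFM_iff_infinite)
    then have "infinite (enumerate a ` {n. enumerate f (enumerate a n) < enumerate h n})"
      using inj_enumerate[OF a] finite_imageD inj_on_subset by blast
    moreover have "enumerate h n \<le> enumerate h (enumerate a n)" for n
      using inf_sets_strict_mono[OF h(1)] le_enumerate[OF a] by (simp add: strict_mono_less_eq)
    then have "enumerate a ` {n. enumerate f (enumerate a n) < enumerate h n}
      \<subseteq> {m\<in>a. enumerate f m < enumerate h m}"
      using enumerate_in_set[OF a] less_le_trans by fast
    ultimately show ?thesis using finite_subset by blast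
  qed
  with h(1) show ?thesis by blast
qed

lemma regularCard_frak_d:
  assumes less: "frak_r <o frak_d"
  shows "regularCard frak_d"
  unfolding regularCard_def
proof (intro allI impI)
  fix K assume K: "K \<subseteq> Field frak_d \<and> cofinal K frak_d"
  obtain D where D: "dominating D" "frak_d = |D|" using frak_d_witness by blast
  obtain A where A: "unreaped A" "frak_r = |A|" using frak_r_witness by blast
  have A_inf: "A \<subseteq> inf_sets" using A(1) by (simp add: unreaped_def)
  have A_small: "|A| <o frak_d" using A(2) less by simp
  have "D \<subseteq> inf_sets" using D(1) by (simp add: dominating_def)
  have FD: "Field frak_d = D" unfolding D(2) by simp
  have "\<not> |K| <o frak_d"
  proof
    assume small: "|K| <o frak_d"
    \<comment> \<open>The field of \<open>frak_d\<close> is the dominating set \<open>D\<close>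
      itself, so a cofinal \<open>K\<close> cuts \<open>D\<close> into the segments
      \<open>under frak_d c\<close>, each smaller than \<open>frak_d\<close>.\<close>
    have "\<exists>h\<in>inf_sets. \<forall>f\<in>under frak_d c. \<forall>a\<in>A. infinite {m\<in>a. enumerate f m < enumerate h m}"
      if "c \<in> K" for c
    proof (rule exceeds_on[OF A_inf A_small])
      show "under frak_d c \<subseteq> inf_sets"
        using under_Field[of frak_d c] FD \<open>D \<subseteq> inf_sets\<close> by blast
      show "|under frak_d c| <o frak_d"
        using card_of_under[OF Card_order_frak_d infinite_Field_frak_d] K that by blast
    qed
    then obtain H where H: "\<And>c. c \<in> K \<Longrightarrow> H c \<in> inf_sets"
      and H': "\<And>c f a. c \<in> K \<Longrightarrow> f \<in> under frak_d c \<Longrightarrow> a \<in> A \<Longrightarrow>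
        infinite {m\<in>a. enumerate f m < enumerate (H c) m}"
      by metis
    have "|H ` K| <o frak_d"
      using small by (rule card_of_image_ordLess)
    moreover have "H ` K \<subseteq> inf_sets" using H by blast
    ultimately have "\<exists>h\<in>inf_sets. \<forall>f\<in>H ` K. \<forall>a\<in>A. infinite {m\<in>a. enumerate f m < enumerate h m}"
      by (intro exceeds_on[OF A_inf A_small])
    then obtain h where h: "h \<in> inf_sets"
      and h': "\<And>c a. c \<in> K \<Longrightarrow> a \<in> A \<Longrightarrow> infinite {m\<in>a. enumerate (H c) m < enumerate h m}"
      by auto
    obtain f where f: "f \<in> D" "\<forall>\<^sub>\<infinity>m. enumerate h m \<le> enumerate f m"
      using D(1) h unfolding dominating_def enum_le_star_def by blast
    obtain c where c: "c \<in> K" "f \<in> under frak_d c"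
      using cofinal_Union_under[of K frak_d] K f(1) FD by blast
    define r where "r = {m. enumerate (H c) m \<le> enumerate f m}"
    have fin: "finite {m. enumerate f m < enumerate h m}"
      using f(2) by (simp add: MOST_iff_cofinite not_le)
    have reap: "infinite (a \<inter> r)" "infinite (a - r)" if "a \<in> A" for a
    proof -
      have "{m\<in>a. enumerate f m < enumerate (H c) m} = a - r" by (auto simp: r_def)
      then show "infinite (a - r)" using H'[OF c that] by simp
      \<comment> \<open>Where \<open>H c\<close> is below \<open>h\<close>, it is also below
        \<open>f\<close>, apart from the finitely many places where \<open>h\<close> exceeds
        \<open>f\<close>.\<close>
      have "{m\<in>a. enumerate (H c) m < enumerate h m} \<subseteq> (a \<inter> r) \<union> {m. enumerate f m < enumerate h m}"
        by (auto simp: r_def)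
      then show "infinite (a \<inter> r)"
        using h'[OF c(1) that] fin by (meson finite_UnI finite_subset)
    qed
    \<comment> \<open>That \<open>r\<close> is infinite is seen from a member of \<open>A\<close>;
      an empty \<open>A\<close> would be reaped by any infinite set.\<close>
    show False
    proof (cases "A = {}")
      case True
      then show False using A(1) unfolding unreaped_def reaps_def inf_sets_def by auto
    next
      case False
      then have "r \<in> inf_sets" using reap by (auto simp: inf_sets_def)
      with reap A(1) show False unfolding unreaped_def reaps_def by blast
    qed
  qed
  moreover have "|K| \<le>o frak_d"
    using K FD D(2) card_of_mono1 by metis
  ultimately show "|K| =o frak_d" using ordLeq_iff_ordLess_or_ordIso by blast
qed

lemma cofinality_ordIso:
  assumes "Card_order r" and "infinite (Field r)" and "regularCard r"
  shows "cofinality r =o r"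
  using cofinality_witness[OF assms(1,2)] assms(3) unfolding regularCard_def by metis

section \<open>Nonexistence of bi-unbounded sets when \<open>frak_r\<close> is below
  \<open>frak_d\<close>\<close>

lemma no_bi_unbounded:
  assumes less: "frak_r <o frak_d"
  shows "\<not> bi_unbounded_card frak_d X"
proof
  assume X: "bi_unbounded_card frak_d X"
  obtain A where A: "unreaped A" "frak_r = |A|" using frak_r_witness by blast
  have A_inf: "infinite (a - {..<k})" if "a \<in> A" for a and k :: nat
    using that A(1) by (auto simp: unreaped_def inf_sets_def)
  have stable: "stable frak_d"
    using regularCard_stable[OF Card_order_frak_d infinite_Field_frak_d regularCard_frak_d[OF less]] .
  \<comment> \<open>The cutoff \<open>k\<close> turns inclusion up to finitely many elements into
    inclusion, so that the common subset \<open>a - {..<k}\<close> bounds each piece of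
    \<open>Y\<close> and the complements of each piece of \<open>Z\<close>. There are still fewer
    than \<open>frak_d\<close> pairs \<open>(a, k)\<close>.\<close>
  define Y where "Y = (\<lambda>(a, k). {x\<in>X. a - {..<k::nat} \<subseteq> x})"
  define Z where "Z = (\<lambda>(a, k). {x\<in>X. a - {..<k::nat} \<subseteq> - x})"
  have "|Y p \<union> Z p| <o frak_d" if p: "p \<in> A \<times> UNIV" for p
  proof (rule Un_ordLess_frak_d)
    obtain a k where ak: "p = (a, k)" "a \<in> A" using p by blast
    have "le_bounded (Y p)"
      by (rule le_bounded_supersets[OF A_inf[OF ak(2), of k]]) (auto simp: Y_def ak)
    moreover have "Y p \<subseteq> X" by (auto simp: Y_def ak)
    ultimately show "|Y p| <o frak_d"
      using X unfolding bi_unbounded_card_def unbounded_card_def by blast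
    have "le_bounded (uminus ` Z p)"
      by (rule le_bounded_supersets[OF A_inf[OF ak(2), of k]]) (auto simp: Z_def ak)
    moreover have "uminus ` Z p \<subseteq> {- x |x. x \<in> X}" by (auto simp: Z_def ak)
    ultimately have "|uminus ` Z p| <o frak_d"
      using X unfolding bi_unbounded_card_def unbounded_card_def by blast
    then have "|uminus ` (uminus ` Z p)| <o frak_d" by (rule card_of_image_ordLess)
    then show "|Z p| <o frak_d" by (simp add: image_image)
  qed
  moreover have "|A \<times> (UNIV :: nat set)| <o frak_d"
    using less nat_ordLess_frak_d unfolding A(2) by (rule Times_ordLess_frak_d)
  ultimately have small: "|\<Union>p \<in> A \<times> UNIV. Y p \<union> Z p| <o frak_d"
    by (intro stable_UNION[OF stable]) auto
  have "X \<subseteq> (\<Union>p \<in> A \<times> UNIV. Y p \<union> Z p)"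
  proof
    fix x assume x: "x \<in> X"
    then have "x \<in> inf_sets" using X by (auto simp: bi_unbounded_card_def unbounded_card_def)
    then obtain a where a: "a \<in> A" "finite (a \<inter> x) \<or> finite (a - x)"
      using A(1) unfolding unreaped_def reaps_def by blast
    from a(2) show "x \<in> (\<Union>p \<in> A \<times> UNIV. Y p \<union> Z p)"
    proof
      assume "finite (a \<inter> x)"
      then obtain k where "a \<inter> x \<subseteq> {..<k}" using finite_nat_iff_bounded by blast
      then have "x \<in> Z (a, k)" using x by (auto simp: Z_def)
      with a(1) show ?thesis by blast
    next
      assume "finite (a - x)"
      then obtain k where "a - x \<subseteq> {..<k}" using finite_nat_iff_bounded by blast
      then have "x \<in> Y (a, k)" using x by (auto simp: Y_def)
      with a(1) show ?thesis by blast
    qed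
  qed
  then have "|X| <o frak_d" using card_of_mono1 small ordLeq_ordLess_trans by blast
  moreover have "frak_d \<le>o |X|" using X by (simp add: bi_unbounded_card_def unbounded_card_def)
  ultimately show False using not_ordLess_ordLeq by blast
qed

lemma bi_unbounded_card_cong:
  assumes "\<kappa> =o \<mu>" and "bi_unbounded_card \<kappa> X"
  shows "bi_unbounded_card \<mu> X"
  using assms unfolding bi_unbounded_card_def unbounded_card_def
  by (meson ordIso_ordLeq_trans ordIso_symmetric ordLess_ordIso_trans)

section \<open>The equivalences\<close>

theorem theorem3p3:
  shows "(frak_d \<le>o frak_r \<longleftrightarrow> (\<exists>X. bi_unbounded_card frak_d X)) \<and>
         ((\<exists>X. bi_unbounded_card frak_d X) \<longleftrightarrow> (\<exists>X. bi_unbounded_card (cofinality frak_d) X))"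
proof (cases "frak_d \<le>o frak_r")
  case le: True
  obtain D where D: "dominating D" "frak_d = |D|" using frak_d_witness by blast
  note d = Card_order_frak_d[unfolded D(2)] infinite_Field_frak_d[unfolded D(2)]
  have "\<exists>X. bi_unbounded_card (card_of D) X"
  proof (rule bi_unbounded_exists[OF le D(1)])
    show "D = (\<Union>c\<in>D. {c})" by blast
    show "|D| \<le>o frak_d" unfolding D(2) by (rule card_of_mono1) simp
    show "|\<Union>c'\<in>under (card_of D) c. {c'}| <o frak_d" if "c \<in> D" for c
      using card_of_under[OF d] that by (simp add: D(2))
  qed
  moreover obtain C where C: "C \<subseteq> D" "cofinal C |D|" "cofinality |D| = |C|"
    and min: "\<And>K. K \<subseteq> D \<Longrightarrow> cofinal K |D| \<Longrightarrow> |C| \<le>o |K|"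
    using cofinality_witness[OF d] by auto
  \<comment> \<open>Two well-orders are in play: \<open>|D|\<close> provides the pieces, while the
    recursion follows \<open>|C|\<close>, which need not agree with \<open>|D|\<close> on
    \<open>C\<close>.\<close>
  have "\<exists>X. bi_unbounded_card (card_of C) X"
  proof (rule bi_unbounded_exists[OF le D(1)])
    show "D = (\<Union>c\<in>C. under (card_of D) c)" using cofinal_Union_under[of C "|D|"] C by simp
    show "|C| \<le>o frak_d" unfolding D(2) using C(1) by (rule card_of_mono1)
    fix c assume c: "c \<in> C"
    have sub: "underS (card_of C) c \<subseteq> C"
      using under_Field[of "|C|" c] underS_subset_under[of "|C|" c] by auto
    have "|underS (card_of C) c| <o |C|" using card_of_underS[OF card_of_Card_order] c by simp
    \<comment> \<open>By minimality of \<open>C\<close>, its proper initial segments in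
      \<open>|C|\<close> are too small to be cofinal in \<open>|D|\<close>, so the pieces met so far
      have a small union.\<close>
    then have "\<not> cofinal (underS (card_of C) c) |D|"
      using min sub C(1) not_ordLess_ordLeq by (meson subset_trans)
    then have "|\<Union>c'\<in>underS (card_of C) c. under (card_of D) c'| <o frak_d"
      using small_not_cofinal_Union_under[OF d, of "underS (card_of C) c"] sub C(1) by (auto simp: D(2))
    moreover have "|under (card_of D) c| <o frak_d" using card_of_under[OF d] c C(1) by (auto simp: D(2))
    ultimately have "|(\<Union>c'\<in>underS (card_of C) c. under (card_of D) c') \<union> under (card_of D) c| <o frak_d"
      by (rule Un_ordLess_frak_d)
    moreover have "(\<Union>c'\<in>under (card_of C) c. under (card_of D) c') \<subseteq>
      (\<Union>c'\<in>underS (card_of C) c. under (card_of D) c') \<union> under (card_of D) c"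
      by (auto simp: underS_def under_def)
    ultimately show "|\<Union>c'\<in>under (card_of C) c. under (card_of D) c'| <o frak_d"
      by (rule ordLeq_ordLess_trans[OF card_of_mono1, rotated])
  qed
  ultimately show ?thesis using le C(3) D(2) by simp
next
  case False
  then have less: "frak_r <o frak_d"
    using Card_order_frak_d Card_order_frak_r by (simp add: card_order_on_def not_ordLeq_iff_ordLess)
  \<comment> \<open>By regularity, a bi-unbounded set for the cofinality would be one for
    \<open>frak_d\<close>, so all three assertions fail in this case.\<close>
  have "cofinality frak_d =o frak_d"
    using cofinality_ordIso[OF Card_order_frak_d infinite_Field_frak_d regularCard_frak_d[OF less]] .
  then show ?thesis
    using False no_bi_unbounded[OF less] bi_unbounded_card_cong by blast
qed

end
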